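(* Let $\mathcal{C}$ and $\mathcal{E}$ be two non-tangent circles in the Euclidean plane that are the circumcircle and the Euler circle, respectively, of some triangle $\triangle ABC$, and let $A_1$ be a point on $\mathcal{C}$. Let $\mathcal{E}'$ be the inverse of $\mathcal{E}$ with respect to $\mathcal{C}$, and let $a'$ be the tangent to $\mathcal{C}$ at $A_1$. Then: (i) if $a'$ does not meet $\mathcal{E}'$ in two distinct points, there is no triangle with vertex $A_1$, circumcircle $\mathcal{C}$ and Euler circle $\mathcal{E}$; (ii) if $a'$ is secant to $\mathcal{E}'$, meeting it in $B'$ and $C'$, then the tangents $b'$ and $c'$ to $\mathcal{C}$ from $B'$ and $C'$ respectively (other than $a'$) touch $\mathcal{C}$ at two other points $B_1$ and $C_1$, and these are, together with $A_1$, the vertices of the required triangle, i.e. $\triangle A_1B_1C_1$ has circumcircle $\mathcal{C}$ and Euler circle $\mathcal{E}$.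
   Context: The Euler circle (nine-point circle) of a triangle is the circle through the midpoints of its three sides. The inverse of a point $P\neq O$ with respect to a circle with center $O$ and radius $R$ is the point $P'$ on the ray $OP$ with $OP\cdot OP'=R^2$; the inverse of a curve is the set of inverses of its points.
   Formalization: In (ii), a tangent from B' (or C') other than a' is claimed to exist only when that point differs from A₁; if A₁ lies on both circles, one of B', C' can be A₁, no such second tangent exists, and the triangle claim is then void. *)

theory Defs
  imports "HOL-Analysis.Analysis"
begin

definition is_circle :: "(real^2) set \<Rightarrow> bool" where
  "is_circle K \<longleftrightarrow> (\<exists>c r. 0 < r \<and> K = sphere c r)"

definition is_line :: "(real^2) set \<Rightarrow> bool" where
  "is_line L \<longleftrightarrow> (\<exists>P Q. P \<noteq> Q \<and> L = affine hull {P, Q})"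

definition is_triangle :: "real^2 \<Rightarrow> real^2 \<Rightarrow> real^2 \<Rightarrow> bool" where
  "is_triangle A B C \<longleftrightarrow> \<not> collinear {A, B, C}"

definition is_circumcircle ::
    "(real^2) set \<Rightarrow> real^2 \<Rightarrow> real^2 \<Rightarrow> real^2 \<Rightarrow> bool" where
  "is_circumcircle K A B C \<longleftrightarrow> is_circle K \<and> A \<in> K \<and> B \<in> K \<and> C \<in> K"

definition is_euler_circle ::
    "(real^2) set \<Rightarrow> real^2 \<Rightarrow> real^2 \<Rightarrow> real^2 \<Rightarrow> bool" where
  "is_euler_circle K A B C \<longleftrightarrow>
     is_circle K \<and> midpoint B C \<in> K \<and> midpoint C A \<in> K \<and> midpoint A B \<in> K"

definition tangent_circles :: "(real^2) set \<Rightarrow> (real^2) set \<Rightarrow> bool" where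
  "tangent_circles K L \<longleftrightarrow> (\<exists>P. K \<inter> L = {P})"

text \<open>Meant for a circle \<open>K\<close>, where meeting \<open>K\<close> in exactly one point characterises tangency.\<close>

definition tangent_at :: "(real^2) set \<Rightarrow> (real^2) set \<Rightarrow> real^2 \<Rightarrow> bool" where
  "tangent_at L K P \<longleftrightarrow> is_line L \<and> L \<inter> K = {P}"

definition tangent_to :: "(real^2) set \<Rightarrow> (real^2) set \<Rightarrow> bool" where
  "tangent_to L K \<longleftrightarrow> (\<exists>P. tangent_at L K P)"

definition meets_in_two_points ::
    "(real^2) set \<Rightarrow> (real^2) set \<Rightarrow> real^2 \<Rightarrow> real^2 \<Rightarrow> bool" where
  "meets_in_two_points L K P Q \<longleftrightarrow> P \<noteq> Q \<and> L \<inter> K = {P, Q}"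

definition ray :: "real^2 \<Rightarrow> real^2 \<Rightarrow> (real^2) set" where
  "ray c P = {c + t *\<^sub>R (P - c) | t. 0 \<le> t}"

definition inverse_point :: "real^2 \<Rightarrow> real \<Rightarrow> real^2 \<Rightarrow> real^2 \<Rightarrow> bool" where
  "inverse_point c R P P' \<longleftrightarrow>
     P \<noteq> c \<and> P' \<in> ray c P \<and> dist c P * dist c P' = R\<^sup>2"

text \<open>The centre \<open>c\<close> has no inverse, so it contributes nothing to the inverse of a curve.\<close>

definition inverse_curve :: "real^2 \<Rightarrow> real \<Rightarrow> (real^2) set \<Rightarrow> (real^2) set" where
  "inverse_curve c R K = {P'. \<exists>P\<in>K. inverse_point c R P P'}"

end

theory Submission
  imports Defs
begin

text \<open>
  Take the centre of \<open>\<C>\<close> as origin. The Euler circle of a triangle inscribed in \<open>\<C>\<close> with vertices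
  \<open>a\<close>, \<open>b\<close>, \<open>d\<close> has centre \<open>h/2\<close>, where \<open>h = a + b + d\<close> is the orthocentre, and radius \<open>R/2\<close>.
  It is tangent to \<open>\<C>\<close> if \<open>|h| = R\<close>, which happens in particular for right triangles.
  The points of the tangent at \<open>a\<close> are the poles of the chords \<open>aq\<close> with \<open>q \<noteq> -a\<close>, that is, the
  inverses of the midpoints of these chords; the point \<open>a\<close> itself, through which no other tangent
  passes, corresponds to \<open>q = a\<close>. Such a pole lies on the inverse of the Euler circle
  iff \<open>(a + q)/2\<close> lies on the circle with centre \<open>h/2\<close> and radius \<open>R/2\<close>, that is, iff
  \<open>|q - (h - a)| = R\<close>. So \<open>q\<close> runs through the intersection of two circles of radius \<open>R\<close> with
  distinct centres \<open>0\<close> and \<open>h - a\<close>; if these meet in two points, then their sum is \<open>h - a\<close>.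
\<close>

section \<open>Lines and circles in the plane\<close>

text \<open>Expanding |x - y|^2 gives r^2 - 2 r^2 + r^2 = 0. For tangents this shows that the point
  of contact is the only common point.\<close>

lemma eq_if_inner_eq_square:
  fixes x y :: "'a::real_inner"
  assumes "norm x = r" "norm y = r" "x \<bullet> y = r\<^sup>2"
  shows "x = y"
proof -
  have "x \<bullet> x = r\<^sup>2" "y \<bullet> y = r\<^sup>2" using assms by (simp_all add: dot_square_norm)
  then have "(x - y) \<bullet> (x - y) = 0"
    unfolding inner_diff_left inner_diff_right using assms(3) by (simp add: inner_commute)
  then show ?thesis by simp
qed

text \<open>In the plane the vectors orthogonal to \<open>w\<close> form a single direction: the
  determinant of \<open>u\<close> and \<open>v\<close> is killed by both coordinates of
  \<open>w\<close>, so it vanishes.\<close>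

lemma orthogonal_vec2_parallel:
  fixes w u v :: "real^2"
  assumes "w \<noteq> 0" "w \<bullet> u = 0" "w \<bullet> v = 0" "u \<noteq> 0"
  shows "\<exists>t. v = t *\<^sub>R u"
proof -
  have w: "w$1 \<noteq> 0 \<or> w$2 \<noteq> 0" and u: "u$1 \<noteq> 0 \<or> u$2 \<noteq> 0"
    using assms(1,4) by (auto simp: vec_eq_iff forall_2)
  have 1: "w$1 * u$1 + w$2 * u$2 = 0" "w$1 * v$1 + w$2 * v$2 = 0"
    using assms(2,3) by (simp_all add: inner_vec_def sum_2)
  then have "w$1 * (u$1 * v$2 - u$2 * v$1) = 0" "w$2 * (u$1 * v$2 - u$2 * v$1) = 0"
    by algebra+
  with w have det: "u$1 * v$2 = u$2 * v$1" by auto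
  show ?thesis
  proof (cases "u$1 = 0")
    case True
    then show ?thesis using u det
      by (intro exI[of _ "v$2 / u$2"]) (auto simp: vec_eq_iff forall_2)
  next
    case False
    then show ?thesis using det
      by (intro exI[of _ "v$1 / u$1"]) (auto simp: vec_eq_iff forall_2 field_simps)
  qed
qed

text \<open>The squared norm differs from |u|^2 by t (t - 1) |v - u|^2, and the last factor is
  nonzero.\<close>

lemma chord_point_norm_eq_iff:
  fixes u v :: "'a::real_inner"
  assumes "u \<noteq> v" "norm v = norm u"
  shows "norm (u + t *\<^sub>R (v - u)) = norm u \<longleftrightarrow> t = 0 \<or> t = 1"
proof -
  have vv: "v \<bullet> v = u \<bullet> u" using assms(2) by (simp add: norm_eq)
  have "(v - u) \<bullet> (v - u) = 2 * (u \<bullet> u - u \<bullet> v)"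
    using vv by (simp add: inner_diff inner_commute)
  with assms(1) have "u \<bullet> u - u \<bullet> v \<noteq> 0"
    by (metis eq_iff_diff_eq_0 inner_eq_zero_iff mult_zero_right)
  moreover have "(u + t *\<^sub>R (v - u)) \<bullet> (u + t *\<^sub>R (v - u)) =
      u \<bullet> u + 2 * (t * (t - 1)) * (u \<bullet> u - u \<bullet> v)"
    using vv by (simp add: inner_diff inner_add_left inner_add_right inner_commute algebra_simps)
  ultimately show ?thesis by (simp add: norm_eq)
qed

text \<open>The line is given by its normal \<open>w\<close>, which suits both later uses: the polar
  of a point and the radical axis of two circles.\<close>

lemma line_meets_sphere_at_most_twice:
  fixes u v x w :: "real^2"
  assumes "w \<noteq> 0" "u \<noteq> v" "w \<bullet> v = w \<bullet> u" "w \<bullet> x = w \<bullet> u"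
    "norm v = norm u" "norm x = norm u"
  shows "x = u \<or> x = v"
proof -
  obtain t where "x - u = t *\<^sub>R (v - u)"
    using orthogonal_vec2_parallel[of w "v - u" "x - u"] assms by (auto simp: inner_diff_right)
  then have x: "x = u + t *\<^sub>R (v - u)" by (simp add: algebra_simps)
  then have "t = 0 \<or> t = 1" using chord_point_norm_eq_iff[OF assms(2,5)] assms(6) by simp
  then show ?thesis using x by auto
qed

lemma distinct_on_sphere_not_collinear:
  fixes A B C c :: "real^2"
  assumes "A \<in> sphere c R" "B \<in> sphere c R" "C \<in> sphere c R"
    "A \<noteq> B" "A \<noteq> C" "B \<noteq> C"
  shows "\<not> collinear {A, B, C}"
proof
  assume "collinear {A, B, C}"
  then obtain t where t: "B = t *\<^sub>R A + (1 - t) *\<^sub>R C"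
    using assms(5) unfolding collinear_3_expand by blast
  define u v where "u = C - c" and "v = A - c"
  have "B - c = u + t *\<^sub>R (v - u)" by (simp add: t u_def v_def algebra_simps)
  moreover have "norm (B - c) = norm u" "norm v = norm u" "u \<noteq> v"
    using assms by (auto simp: u_def v_def dist_norm norm_minus_commute)
  ultimately have "t = 0 \<or> t = 1" using chord_point_norm_eq_iff by metis
  then show False using t assms by auto
qed

section \<open>Tangent lines of a circle\<close>

text \<open>This replaces tangency by a linear equation, that of the polar of \<open>P\<close>. A
  line through \<open>P\<close> not orthogonal to the radius would meet the circle a second
  time.\<close>

lemma tangent_at_sphere_iff:
  fixes c P :: "real^2"
  assumes "0 < R"
  shows "tangent_at L (sphere c R) P \<longleftrightarrow>
    norm (P - c) = R \<and> L = {X. (X - c) \<bullet> (P - c) = R\<^sup>2}"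
proof
  assume t: "tangent_at L (sphere c R) P"
  then have "P \<in> L \<inter> sphere c R" by (auto simp: tangent_at_def)
  then have PL: "P \<in> L" and P: "norm (P - c) = R" by (auto simp: dist_norm norm_minus_commute)
  define p where "p = P - c"
  have pp: "p \<bullet> p = R\<^sup>2" using P by (simp add: p_def dot_square_norm)
  obtain U V where UV: "U \<noteq> V" "L = affine hull {U, V}"
    using t by (auto simp: tangent_at_def is_line_def)
  obtain s where s: "P = U + s *\<^sub>R (V - U)"
    using PL by (auto simp: UV affine_hull_2_alt)
  define d where "d = V - U"
  have d: "d \<noteq> 0" using UV by (simp add: d_def)
  have L: "L = range (\<lambda>t. P + t *\<^sub>R d)"
  proof -
    have "U + r *\<^sub>R d = P + (r - s) *\<^sub>R d" "P + r *\<^sub>R d = U + (r + s) *\<^sub>R d" for r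
      by (simp_all add: s d_def algebra_simps)
    then show ?thesis unfolding UV affine_hull_2_alt d_def[symmetric]
      by (metis (no_types, lifting) range_eqI subsetI subset_antisym rangeE)
  qed
  have pd: "p \<bullet> d = 0"
  proof -
    \<comment> \<open>The parameter of the second intersection of the line with the circle: the root
      other than 0 of r (2 p.d + r d.d) = 0. As this point must be \<open>P\<close> again,
      \<open>r\<close> is 0 and \<open>p\<close> is orthogonal to \<open>d\<close>.\<close>
    define r where "r = - 2 * (p \<bullet> d) / (d \<bullet> d)"
    have "(p + r *\<^sub>R d) \<bullet> (p + r *\<^sub>R d) = R\<^sup>2 + r * (2 * (p \<bullet> d) + r * (d \<bullet> d))"
      by (simp add: inner_add pp inner_commute algebra_simps)
    also have "\<dots> = R\<^sup>2" using d by (simp add: r_def)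
    finally have "norm (p + r *\<^sub>R d) = R" using assms by (simp add: norm_eq_sqrt_inner)
    moreover have "p + r *\<^sub>R d = P + r *\<^sub>R d - c" by (simp add: p_def)
    ultimately have "norm (P + r *\<^sub>R d - c) = R" by simp
    then have "P + r *\<^sub>R d \<in> L \<inter> sphere c R"
      unfolding L sphere_def dist_norm norm_minus_commute[of c] by auto
    then have "P + r *\<^sub>R d = P" using t unfolding tangent_at_def by blast
    then show ?thesis using d by (simp add: r_def)
  qed
  have p0: "p \<noteq> 0" using pp assms by auto
  have "L = {X. (X - c) \<bullet> p = R\<^sup>2}"
  proof (intro set_eqI iffI)
    fix X assume "X \<in> L"
    then obtain r where "X = P + r *\<^sub>R d" by (auto simp: L)
    then have "X - c = p + r *\<^sub>R d" by (simp add: p_def)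
    then show "X \<in> {X. (X - c) \<bullet> p = R\<^sup>2}"
      using pp pd by (simp add: inner_add_left inner_commute[of d])
  next
    fix X assume "X \<in> {X. (X - c) \<bullet> p = R\<^sup>2}"
    then have "p \<bullet> (X - P) = 0"
      using pp by (simp add: p_def inner_diff inner_commute)
    then obtain r where "X - P = r *\<^sub>R d"
      using orthogonal_vec2_parallel[of p d "X - P"] p0 pd d by auto
    then show "X \<in> L" by (auto simp: L intro!: range_eqI[of _ _ r] simp: algebra_simps)
  qed
  with P show "norm (P - c) = R \<and> L = {X. (X - c) \<bullet> (P - c) = R\<^sup>2}" by (simp add: p_def)
next
  assume *: "norm (P - c) = R \<and> L = {X. (X - c) \<bullet> (P - c) = R\<^sup>2}"
  define p where "p = P - c"
  have pp: "p \<bullet> p = R\<^sup>2" using * by (simp add: p_def dot_square_norm)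
  have p0: "p \<noteq> 0" using pp assms by auto
  \<comment> \<open>The radius vector turned by a right angle is the direction of the
    tangent.\<close>
  define d :: "real^2" where "d = vector [- p$2, p$1]"
  have pd: "p \<bullet> d = 0" by (simp add: d_def inner_vec_def sum_2)
  have d: "d \<noteq> 0" using p0 by (auto simp: d_def vec_eq_iff forall_2)
  have "L = affine hull {P, P + d}"
  proof (intro set_eqI iffI)
    fix X assume "X \<in> L"
    then have "(X - c) \<bullet> p = R\<^sup>2" using * by (simp add: p_def)
    then have "p \<bullet> (X - P) = 0"
      using pp by (simp add: p_def inner_diff inner_commute)
    then obtain r where "X - P = r *\<^sub>R d"
      using orthogonal_vec2_parallel[of p d "X - P"] p0 pd d by auto
    then show "X \<in> affine hull {P, P + d}"
      by (auto simp: affine_hull_2_alt intro!: range_eqI[of _ _ r] simp: algebra_simps)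
  next
    fix X assume "X \<in> affine hull {P, P + d}"
    then obtain r where "X = P + r *\<^sub>R d" by (auto simp: affine_hull_2_alt)
    then have "X - c = p + r *\<^sub>R d" by (simp add: p_def)
    then have "(X - c) \<bullet> p = R\<^sup>2" using pp pd by (simp add: inner_add_left inner_commute[of d])
    then show "X \<in> L" using * by (simp add: p_def)
  qed
  then have "is_line L" using d unfolding is_line_def by (metis add_cancel_right_right)
  moreover have "L \<inter> sphere c R = {P}"
  proof -
    have "X = P" if "X \<in> L" "X \<in> sphere c R" for X
    proof -
      have "norm (X - c) = R" "(X - c) \<bullet> p = R\<^sup>2"
        using that * by (simp_all add: p_def dist_norm norm_minus_commute)
      then have "X - c = p" using eq_if_inner_eq_square[of "X - c" R p] * by (simp add: p_def)
      then show ?thesis by (simp add: p_def)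
    qed
    moreover have "P \<in> L" using * pp by (simp add: p_def)
    moreover have "P \<in> sphere c R" using * by (simp add: dist_norm norm_minus_commute)
    ultimately show ?thesis by blast
  qed
  ultimately show "tangent_at L (sphere c R) P" by (simp add: tangent_at_def)
qed

lemma tangent_at_sphere_point_eq_iff:
  assumes "0 < R" "tangent_at L (sphere c R) P" "tangent_at L' (sphere c R) P'"
  shows "L = L' \<longleftrightarrow> P = P'"
  using assms(2,3) unfolding tangent_at_sphere_iff[OF assms(1)]
  by (metis assms(2,3) tangent_at_def singleton_inject)

section \<open>The Euler circle\<close>

text \<open>The homothety with centre \<open>P\<close> and ratio 2 sends the midpoint to
  \<open>Q\<close> and the circle to one of radius \<open>R\<close> whose centre, seen from
  \<open>c\<close>, is \<open>h - (P - c)\<close>.\<close>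

lemma midpoint_on_sphere_iff:
  fixes P Q S c h :: "real^2"
  shows "midpoint P Q \<in> sphere (c + (1/2) *\<^sub>R h) (R/2) \<longleftrightarrow>
    norm (Q - c - (h - (P - c))) = R"
proof -
  have "c + (1/2) *\<^sub>R h - midpoint P Q = (-1/2) *\<^sub>R (Q - c - (h - (P - c)))"
    by (simp add: midpoint_def algebra_simps vec_eq_iff)
  then show ?thesis by (simp add: dist_norm)
qed

text \<open>Besides the known centre and radius, this needs that only one circle passes through the
  three midpoints.\<close>

lemma is_euler_circle_iff:
  fixes A B C c :: "real^2"
  assumes "0 < R" "is_triangle A B C" "is_circumcircle (sphere c R) A B C"
  shows "is_euler_circle K A B C \<longleftrightarrow>
    K = sphere (c + (1/2) *\<^sub>R ((A - c) + (B - c) + (C - c))) (R/2)"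
proof -
  define a b d where "a = A - c" and "b = B - c" and "d = C - c"
  have n: "norm a = R" "norm b = R" "norm d = R"
    using assms(3) by (auto simp: is_circumcircle_def a_def b_def d_def dist_norm norm_minus_commute)
  define m where "m = c + (1/2) *\<^sub>R (a + b + d)"
  have euler: "is_euler_circle (sphere m (R/2)) A B C"
    using assms(1) n unfolding is_euler_circle_def is_circle_def m_def midpoint_on_sphere_iff
    by (auto simp: a_def b_def d_def norm_minus_commute algebra_simps intro!: exI[of _ "R/2"])
  have "K = sphere m (R/2)" if K: "is_euler_circle K A B C"
  proof -
    obtain e r where e: "K = sphere e r" using K by (auto simp: is_euler_circle_def is_circle_def)
    define z where "z = e - m"
    have mid: "midpoint B C = m - (1/2) *\<^sub>R a" "midpoint C A = m - (1/2) *\<^sub>R b"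
       "midpoint A B = m - (1/2) *\<^sub>R d"
      by (simp_all add: m_def a_def b_def d_def midpoint_def vec_eq_iff field_simps)
    have "norm (z + (1/2) *\<^sub>R a) = r" "norm (z + (1/2) *\<^sub>R b) = r" "norm (z + (1/2) *\<^sub>R d) = r"
      using K unfolding is_euler_circle_def mid e by (simp_all add: dist_norm z_def algebra_simps)
    then have "(z + (1/2) *\<^sub>R a) \<bullet> (z + (1/2) *\<^sub>R a) = r\<^sup>2" "(z + (1/2) *\<^sub>R b) \<bullet> (z + (1/2) *\<^sub>R b) = r\<^sup>2"
       "(z + (1/2) *\<^sub>R d) \<bullet> (z + (1/2) *\<^sub>R d) = r\<^sup>2"
      by (simp_all add: dot_square_norm)
    moreover have "a \<bullet> a = R\<^sup>2" "b \<bullet> b = R\<^sup>2" "d \<bullet> d = R\<^sup>2" using n by (simp_all add: dot_square_norm)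
    \<comment> \<open>Subtracting the three equations cancels all squares, since \<open>a\<close>,
      \<open>b\<close> and \<open>d\<close> have equal norms.\<close>
    ultimately have z: "z \<bullet> (b - a) = 0" "z \<bullet> (d - a) = 0"
      by (simp_all add: inner_add inner_diff inner_commute)
    \<comment> \<open>Otherwise both sides \<open>b - a\<close> and \<open>d - a\<close> are
      orthogonal to one direction, hence parallel, and the triangle degenerates.\<close>
    have z0: "z = 0"
    proof (rule ccontr)
      assume nz: "z \<noteq> 0"
      have nc: "\<not> collinear {A, B, C}" using assms(2) by (simp add: is_triangle_def)
      then have "b - a \<noteq> 0" by (auto simp: a_def b_def)
      then obtain t where "d - a = t *\<^sub>R (b - a)"
        using orthogonal_vec2_parallel[OF nz z] by auto
      then have "C = t *\<^sub>R B + (1 - t) *\<^sub>R A" by (simp add: a_def b_def d_def algebra_simps)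
      then have "collinear {B, C, A}" by (auto simp: collinear_3_expand)
      with nc show False by (simp add: insert_commute)
    qed
    have "m - (1/2) *\<^sub>R a \<in> K" "m - (1/2) *\<^sub>R a \<in> sphere m (R/2)"
      using K n unfolding mid[symmetric] by (simp_all add: is_euler_circle_def mid dist_norm)
    then have "r = R/2" using z0 unfolding e z_def sphere_def by simp
    moreover have "e = m" using z0 by (simp add: z_def)
    ultimately show ?thesis unfolding e by metis
  qed
  with euler show ?thesis unfolding m_def a_def b_def d_def by blast
qed

text \<open>The second circle has the segment from \<open>c\<close> to \<open>c + h\<close> as
  diameter. Its equation reads x.h = x.x, which on the first circle forces x = h. Non-tangency
  thereby excludes an orthocentre on the circumcircle.\<close>

lemma spheres_internally_tangent:
  fixes c h :: "real^2"
  assumes "norm h = R"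
  shows "tangent_circles (sphere c R) (sphere (c + (1/2) *\<^sub>R h) (R/2))"
proof -
  have "X = c + h" if "X \<in> sphere c R" "X \<in> sphere (c + (1/2) *\<^sub>R h) (R/2)" for X
  proof -
    define x where "x = X - c"
    have x: "norm x = R" using that by (simp add: x_def dist_norm norm_minus_commute)
    then have xx: "x \<bullet> x = R\<^sup>2" by (simp add: dot_square_norm)
    have hh: "h \<bullet> h = R\<^sup>2" using assms by (simp add: dot_square_norm)
    have "norm (x - (1/2) *\<^sub>R h) = R/2"
      using that by (simp add: x_def dist_norm norm_minus_commute algebra_simps)
    then have "(x - (1/2) *\<^sub>R h) \<bullet> (x - (1/2) *\<^sub>R h) = (R/2)\<^sup>2"
      unfolding dot_square_norm by (rule arg_cong)
    then have "x \<bullet> h = R\<^sup>2"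
      using xx hh by (simp add: inner_diff inner_commute power_divide field_simps)
    then have "x = h" using eq_if_inner_eq_square x assms by blast
    then show ?thesis by (simp add: x_def algebra_simps)
  qed
  moreover have "c + h \<in> sphere c R" using assms by (simp add: dist_norm)
  moreover have "c + h \<in> sphere (c + (1/2) *\<^sub>R h) (R/2)"
  proof -
    have *: "c + (1/2) *\<^sub>R h - (c + h) = (-1/2) *\<^sub>R h" by (simp add: vec_eq_iff)
    show ?thesis using assms unfolding sphere_def dist_norm mem_Collect_eq * by simp
  qed
  ultimately show ?thesis unfolding tangent_circles_def by blast
qed

section \<open>Inversion and poles of chords\<close>

text \<open>On the ray the product of the distances is t |P - c|^2, which determines
  \<open>t\<close>.\<close>

lemma inverse_point_iff:
  assumes "0 < R"
  shows "inverse_point c R P X \<longleftrightarrow>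
    P \<noteq> c \<and> X = c + (R\<^sup>2 / (norm (P - c))\<^sup>2) *\<^sub>R (P - c)"
proof (cases "P = c")
  case False
  define p where "p = P - c"
  have p: "norm p \<noteq> 0" using False by (simp add: p_def)
  have "inverse_point c R P X \<longleftrightarrow> (\<exists>t\<ge>0. X = c + t *\<^sub>R p \<and> norm p * norm (X - c) = R\<^sup>2)"
    using False by (auto simp: inverse_point_def ray_def p_def dist_norm norm_minus_commute)
  also have "\<dots> \<longleftrightarrow> (\<exists>t\<ge>0. X = c + t *\<^sub>R p \<and> t = R\<^sup>2 / (norm p)\<^sup>2)"
    using p by (auto simp: power2_eq_square field_simps)
  also have "\<dots> \<longleftrightarrow> X = c + (R\<^sup>2 / (norm p)\<^sup>2) *\<^sub>R p" by auto
  finally show ?thesis using False by (simp add: p_def)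
qed (simp add: inverse_point_def)

text \<open>The inverse of the midpoint of \<open>a\<close> and \<open>q\<close> in the circle about
  0 through \<open>a\<close>. For opposite points the value is 0 by default and has no geometric
  meaning.\<close>

definition pole :: "real^2 \<Rightarrow> real^2 \<Rightarrow> real^2" where
  "pole a q = (2 * (norm a)\<^sup>2 / (norm (a + q))\<^sup>2) *\<^sub>R (a + q)"

lemma pole_self:
  assumes "a \<noteq> 0"
  shows "pole a a = a"
  using assms by (simp add: pole_def power2_eq_square flip: scaleR_2)

context
  fixes a q :: "real^2" and R :: real
  assumes R: "0 < R" and a: "norm a = R" and q: "norm q = R" and nz: "a + q \<noteq> 0"
begin

text \<open>Both a.(a + q) and q.(a + q) are half of this value, so the scaling in
  \<open>pole\<close> puts the pole on the tangents at \<open>a\<close> and at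
  \<open>q\<close>.\<close>

lemma norm_add_on_circle: "(norm (a + q))\<^sup>2 = 2 * (R\<^sup>2 + a \<bullet> q)"
proof -
  have "a \<bullet> a = R\<^sup>2" "q \<bullet> q = R\<^sup>2" using a q by (simp_all add: dot_square_norm)
  then show ?thesis
    unfolding dot_square_norm[symmetric] by (simp add: inner_add inner_commute)
qed

lemma pole_inner_left: "pole a q \<bullet> a = R\<^sup>2"
proof -
  have *: "(a + q) \<bullet> a = (norm (a + q))\<^sup>2 / 2"
    unfolding norm_add_on_circle inner_add_left using a
    by (simp add: inner_commute dot_square_norm)
  show ?thesis unfolding pole_def inner_scaleR_left * using nz a by simp
qed

lemma pole_inner_right: "pole a q \<bullet> q = R\<^sup>2"
proof -
  have *: "(a + q) \<bullet> q = (norm (a + q))\<^sup>2 / 2"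
    unfolding norm_add_on_circle inner_add_left using q by (simp add: dot_square_norm)
  show ?thesis unfolding pole_def inner_scaleR_left * using nz a by simp
qed

lemma pole_nonzero: "pole a q \<noteq> 0"
  using pole_inner_left R by auto

text \<open>A point of contact of a tangent through the pole lies on the polar line, which meets the
  circle only in \<open>a\<close> and \<open>q\<close>. If \<open>q = a\<close>, the pole is
  \<open>a\<close> itself and no second tangent exists.\<close>

lemma pole_chord_endpoint:
  assumes "norm p = R" "pole a q \<bullet> p = R\<^sup>2" "p \<noteq> a"
  shows "p = q \<and> q \<noteq> a"
proof (cases "q = a")
  case True
  then have "a \<bullet> p = R\<^sup>2" using assms(2) pole_self[of a] R a by auto
  then have "a = p" using eq_if_inner_eq_square[OF a assms(1)] by blast
  then show ?thesis using assms(3) by simp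
next
  case False
  then show ?thesis
    using line_meets_sphere_at_most_twice[of "pole a q" a q p]
      pole_nonzero pole_inner_left pole_inner_right a q assms by auto
qed

end

text \<open>As a function of \<open>a + q\<close>, the pole is an inversion of power 2 |a|^2, which
  is its own inverse.\<close>

lemma pole_inj:
  assumes "norm a \<noteq> 0" "a + q \<noteq> 0" "a + q' \<noteq> 0" "pole a q = pole a q'"
  shows "q = q'"
proof -
  have inv: "a + p = (2 * (norm a)\<^sup>2 / (norm (pole a p))\<^sup>2) *\<^sub>R pole a p" if "a + p \<noteq> 0" for p
  proof -
    have "norm (pole a p) = 2 * (norm a)\<^sup>2 / norm (a + p)"
      using that by (simp add: pole_def power2_eq_square)
    then have "2 * (norm a)\<^sup>2 / (norm (pole a p))\<^sup>2 * (2 * (norm a)\<^sup>2 / (norm (a + p))\<^sup>2) = 1"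
      using that assms(1) by (simp add: power2_eq_square)
    then show ?thesis by (simp add: pole_def)
  qed
  have "a + q = a + q'" using inv[OF assms(2)] inv[OF assms(3)] assms(4) by simp
  then show ?thesis by simp
qed

text \<open>For \<open>X\<close> inverse to \<open>P\<close>, lying on the tangent at
  \<open>A\<close> means that \<open>P\<close> is on the circle with diameter from \<open>c\<close>
  to \<open>A\<close>, so that \<open>P\<close> is the midpoint of a chord from
  \<open>A\<close>.\<close>

lemma inverse_euler_circle_inter_tangent_iff:
  fixes c A h :: "real^2"
  assumes R: "0 < R" and A: "norm (A - c) = R"
  shows "X \<in> inverse_curve c R (sphere (c + (1/2) *\<^sub>R h) (R/2)) \<and> (X - c) \<bullet> (A - c) = R\<^sup>2 \<longleftrightarrow>
    (\<exists>q. norm q = R \<and> norm (q - (h - (A - c))) = R \<and> (A - c) + q \<noteq> 0 \<and> X = c + pole (A - c) q)"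
    (is "?l \<longleftrightarrow> ?r")
proof
  define a where "a = A - c"
  assume ?l
  then obtain P where P: "P \<in> sphere (c + (1/2) *\<^sub>R h) (R/2)" "P \<noteq> c"
    "X = c + (R\<^sup>2 / (norm (P - c))\<^sup>2) *\<^sub>R (P - c)"
    by (auto simp: inverse_curve_def inverse_point_iff[OF R])
  \<comment> \<open>The reflection of \<open>A\<close> in \<open>P\<close>, seen from
    \<open>c\<close>: the other end of the chord.\<close>
  define q where "q = 2 *\<^sub>R (P - c) - a"
  have aq: "P - c = (1/2) *\<^sub>R (a + q)" by (simp add: q_def)
  have pn: "norm (P - c) \<noteq> 0" using P by simp
  have "(X - c) \<bullet> a = R\<^sup>2" using \<open>?l\<close> by (simp add: a_def)
  then have "R\<^sup>2 / (norm (P - c))\<^sup>2 * ((P - c) \<bullet> a) = R\<^sup>2" by (simp add: P(3))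
  then have "(P - c) \<bullet> a = (P - c) \<bullet> (P - c)"
    using R pn by (simp add: field_simps dot_square_norm)
  then have "q \<bullet> q = a \<bullet> a"
    unfolding q_def
    by (simp only: inner_diff_left[of "2 *\<^sub>R (P - c)"] inner_diff_right[of _ "2 *\<^sub>R (P - c)"]
        inner_scaleR_left inner_scaleR_right inner_commute[of a "P - c"]) simp
  then have qR: "norm q = R" using A by (simp add: a_def flip: norm_eq)
  have "midpoint A (c + q) = P" by (simp add: midpoint_def q_def a_def vec_eq_iff)
  then have "norm (q - (h - a)) = R"
    using P(1) midpoint_on_sphere_iff[of A "c + q" c h R] by (simp add: a_def)
  moreover have "a + q \<noteq> 0" using aq P by auto
  moreover have "X = c + pole a q"
    using A unfolding P(3) aq by (simp add: pole_def a_def power_mult_distrib power_divide)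
  ultimately show ?r using qR by (auto simp: a_def)
next
  assume ?r
  then obtain q where q: "norm q = R" "norm (q - (h - (A - c))) = R" "(A - c) + q \<noteq> 0"
    "X = c + pole (A - c) q" by auto
  define P where "P = midpoint A (c + q)"
  have aq: "P - c = (1/2) *\<^sub>R ((A - c) + q)" by (simp add: P_def midpoint_def vec_eq_iff)
  have "P \<in> sphere (c + (1/2) *\<^sub>R h) (R/2)" 
    unfolding P_def midpoint_on_sphere_iff using q(2) by simp
  moreover have "inverse_point c R P X"
  proof -
    have "P - c \<noteq> 0" unfolding aq using q(3) by simp
    then have "P \<noteq> c" by simp
    then show ?thesis
      unfolding inverse_point_iff[OF R] aq q(4) using A
      by (simp add: pole_def power_mult_distrib power_divide)
  qed
  ultimately show ?l
    using pole_inner_left[OF R A q(1,3)] q(4) by (auto simp: inverse_curve_def)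
qed

section \<open>Intersection of two circles of equal radius\<close>

text \<open>Subtracting the two equations leaves the radical axis D.y = D.D / 2, a line with normal
  \<open>D\<close>.\<close>

lemma equal_spheres_inter:
  fixes b e x D :: "real^2"
  assumes "D \<noteq> 0" "b \<noteq> e"
    "norm b = R" "norm (b - D) = R" "norm e = R" "norm (e - D) = R"
    "norm x = R" "norm (x - D) = R"
  shows "x = b \<or> x = e"
proof -
  have D: "D \<bullet> y = (D \<bullet> D) / 2" if "norm y = R" "norm (y - D) = R" for y
  proof -
    have "(y - D) \<bullet> (y - D) = y \<bullet> y" using that by (simp add: norm_eq[symmetric])
    then show ?thesis by (simp add: inner_diff inner_commute)
  qed
  show ?thesis using line_meets_sphere_at_most_twice[OF assms(1,2)] D assms(3-) by auto
qed

text \<open>The point reflection y -> D - y swaps the circles, hence permutes \<open>b\<close> and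
  \<open>e\<close>. It cannot fix both, having only one fixed point.\<close>

lemma equal_spheres_inter_sum:
  fixes b e D :: "real^2"
  assumes "D \<noteq> 0" "b \<noteq> e"
    "norm b = R" "norm (b - D) = R" "norm e = R" "norm (e - D) = R"
  shows "b + e = D"
proof -
  have "norm (D - b) = R" "norm ((D - b) - D) = R" "norm (D - e) = R" "norm ((D - e) - D) = R"
    using assms by (simp_all add: norm_minus_commute)
  then have "D - b = b \<or> D - b = e" "D - e = b \<or> D - e = e"
    using equal_spheres_inter[OF assms] by blast+
  moreover have "\<not> (D - b = b \<and> D - e = e)"
  proof
    assume "D - b = b \<and> D - e = e"
    then have "2 *\<^sub>R b = 2 *\<^sub>R e" by (metis diff_add_cancel scaleR_2)
    then show False using assms(2) by simp
  qed
  ultimately show ?thesis by (metis add.commute diff_add_cancel)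
qed

section \<open>Second tangents and the triangle\<close>

lemma ex1_other_tangent:
  fixes c A q :: "real^2"
  assumes R: "0 < R" and L: "tangent_at L (sphere c R) A"
    and q: "norm q = R" "(A - c) + q \<noteq> 0" "q \<noteq> A - c"
  shows "\<exists>!L'. tangent_to L' (sphere c R) \<and> c + pole (A - c) q \<in> L' \<and> L' \<noteq> L"
proof (rule ex1I)
  have A: "norm (A - c) = R" using L by (simp add: tangent_at_sphere_iff[OF R])
  let ?M = "{X. (X - c) \<bullet> q = R\<^sup>2}"
  have M: "tangent_at ?M (sphere c R) (c + q)"
    using q(1) by (simp add: tangent_at_sphere_iff[OF R])
  have "?M \<noteq> L" using tangent_at_sphere_point_eq_iff[OF R M L] q(3) by auto
  then show "tangent_to ?M (sphere c R) \<and> c + pole (A - c) q \<in> ?M \<and> ?M \<noteq> L"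
    using M pole_inner_right[OF R A q(1,2)] by (auto simp: tangent_to_def)
  fix L' assume L': "tangent_to L' (sphere c R) \<and> c + pole (A - c) q \<in> L' \<and> L' \<noteq> L"
  then obtain P where P: "tangent_at L' (sphere c R) P" by (auto simp: tangent_to_def)
  then have P': "norm (P - c) = R" "L' = {X. (X - c) \<bullet> (P - c) = R\<^sup>2}"
    by (simp_all add: tangent_at_sphere_iff[OF R])
  have "P \<noteq> A" using tangent_at_sphere_point_eq_iff[OF R P L] L' by simp
  then have "P - c = q"
    using pole_chord_endpoint[OF R A q(1,2) P'(1)] P'(2) L' by simp
  then show "L' = ?M" using P'(2) by simp
qed

text \<open>If \<open>B'\<close> or \<open>C'\<close> is \<open>A\<^sub>1\<close>, no tangent other
  than \<open>a'\<close> passes through it; hence the guards on unique existence.\<close>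

theorem corollary3:
  fixes c A\<^sub>1 :: "real^2" and R :: real
    and \<C> \<E> \<E>' a' :: "(real^2) set"
  assumes "0 < R"
    and "\<C> = sphere c R"
    and "\<exists>A B C. is_triangle A B C \<and> is_circumcircle \<C> A B C \<and> is_euler_circle \<E> A B C"
    and "\<not> tangent_circles \<C> \<E>"
    and "A\<^sub>1 \<in> \<C>"
    and "\<E>' = inverse_curve c R \<E>"
    and "tangent_at a' \<C> A\<^sub>1"
  shows
    "((\<nexists>B' C'. meets_in_two_points a' \<E>' B' C') \<longrightarrow>
        (\<nexists>B\<^sub>1 C\<^sub>1. is_triangle A\<^sub>1 B\<^sub>1 C\<^sub>1 \<and> is_circumcircle \<C> A\<^sub>1 B\<^sub>1 C\<^sub>1
                  \<and> is_euler_circle \<E> A\<^sub>1 B\<^sub>1 C\<^sub>1))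
     \<and>
     (\<forall>B' C'. meets_in_two_points a' \<E>' B' C' \<longrightarrow>
        (B' \<noteq> A\<^sub>1 \<longrightarrow> (\<exists>!b'. tangent_to b' \<C> \<and> B' \<in> b' \<and> b' \<noteq> a')) \<and>
        (C' \<noteq> A\<^sub>1 \<longrightarrow> (\<exists>!c'. tangent_to c' \<C> \<and> C' \<in> c' \<and> c' \<noteq> a')) \<and>
        (\<forall>b' c'.
           tangent_to b' \<C> \<and> B' \<in> b' \<and> b' \<noteq> a' \<and>
           tangent_to c' \<C> \<and> C' \<in> c' \<and> c' \<noteq> a' \<longrightarrow>
           (\<exists>B\<^sub>1 C\<^sub>1. tangent_at b' \<C> B\<^sub>1 \<and> tangent_at c' \<C> C\<^sub>1 \<and>
              B\<^sub>1 \<noteq> A\<^sub>1 \<and> C\<^sub>1 \<noteq> A\<^sub>1 \<and> B\<^sub>1 \<noteq> C\<^sub>1 \<and>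
              is_triangle A\<^sub>1 B\<^sub>1 C\<^sub>1 \<and> is_circumcircle \<C> A\<^sub>1 B\<^sub>1 C\<^sub>1
              \<and> is_euler_circle \<E> A\<^sub>1 B\<^sub>1 C\<^sub>1)))"
proof -
  note R = assms(1)
  define a where "a = A\<^sub>1 - c"
  have A: "norm (A\<^sub>1 - c) = R" using assms(2,5) by (simp add: dist_norm norm_minus_commute)
  have T: "tangent_at a' (sphere c R) A\<^sub>1" using assms(2,7) by simp
  have a': "a' = {X. (X - c) \<bullet> (A\<^sub>1 - c) = R\<^sup>2}" using T by (simp add: tangent_at_sphere_iff[OF R])
  obtain h where E: "\<E> = sphere (c + (1/2) *\<^sub>R h) (R/2)"
    using assms(2,3) is_euler_circle_iff[OF R] by blast
  \<comment> \<open>Non-tangency enters here. It keeps the centres 0 and \<open>h - a\<close>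
    distinct and, below, keeps the vertices from being opposite to \<open>A\<^sub>1\<close>.\<close>
  have h: "norm h \<noteq> R" using assms(2,4) spheres_internally_tangent E by blast
  have a: "norm a = R" using A by (simp add: a_def)
  have D: "h - a \<noteq> 0" using h a by auto
  have key: "X \<in> a' \<inter> \<E>' \<longleftrightarrow>
      (\<exists>q. norm q = R \<and> norm (q - (h - a)) = R \<and> a + q \<noteq> 0 \<and> X = c + pole a q)" for X
    using inverse_euler_circle_inter_tangent_iff[OF R A, of X h] assms(6) E
    by (auto simp: a' a_def)
  \<comment> \<open>Part (i) by contraposition: the poles of the two sides through
    \<open>A\<^sub>1\<close> are the two intersections.\<close>
  have "\<exists>B' C'. meets_in_two_points a' \<E>' B' C'"
    if tri: "is_triangle A\<^sub>1 B C" "is_circumcircle \<C> A\<^sub>1 B C" "is_euler_circle \<E> A\<^sub>1 B C" for B C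
  proof -
    define b e where "b = B - c" and "e = C - c"
    have n: "norm b = R" "norm e = R"
      using tri(2) assms(2) by (auto simp: is_circumcircle_def b_def e_def dist_norm norm_minus_commute)
    have be: "b \<noteq> e"
      using tri(1) by (auto simp: is_triangle_def b_def e_def)
    have hb: "norm (b - (h - a)) = R" "norm (e - (h - a)) = R"
      using tri(3) midpoint_sym[of C A\<^sub>1]
      unfolding is_euler_circle_def E a_def b_def e_def
      by (metis midpoint_on_sphere_iff)+
    have he: "h = a + b + e"
      using equal_spheres_inter_sum[OF D be n(1) hb(1) n(2) hb(2)] by (simp add: algebra_simps)
    \<comment> \<open>Otherwise \<open>h = e\<close>, which has norm \<open>R\<close>.\<close>
    have nb: "a + b \<noteq> 0" using h n he by auto
    have ne: "a + e \<noteq> 0"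
    proof
      assume "a + e = 0"
      then have "h = b" by (simp add: he algebra_simps)
      with h n show False by simp
    qed
    have "c + pole a b \<noteq> c + pole a e"
      using pole_inj[OF _ nb ne] be a R by auto
    moreover have "a' \<inter> \<E>' = {c + pole a b, c + pole a e}"
    proof (intro set_eqI iffI)
      fix X assume "X \<in> a' \<inter> \<E>'"
      then obtain q where "norm q = R" "norm (q - (h - a)) = R" "X = c + pole a q"
        unfolding key by blast
      then show "X \<in> {c + pole a b, c + pole a e}"
        using equal_spheres_inter[OF D be n(1) hb(1) n(2) hb(2)] by blast
    next
      fix X assume "X \<in> {c + pole a b, c + pole a e}"
      then show "X \<in> a' \<inter> \<E>'" unfolding key using n hb nb ne by blast
    qed
    ultimately show ?thesis unfolding meets_in_two_points_def by blast
  qed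
  moreover have
    "(B' \<noteq> A\<^sub>1 \<longrightarrow> (\<exists>!b'. tangent_to b' \<C> \<and> B' \<in> b' \<and> b' \<noteq> a')) \<and>
     (C' \<noteq> A\<^sub>1 \<longrightarrow> (\<exists>!c'. tangent_to c' \<C> \<and> C' \<in> c' \<and> c' \<noteq> a')) \<and>
     (\<forall>b' c'.
        tangent_to b' \<C> \<and> B' \<in> b' \<and> b' \<noteq> a' \<and>
        tangent_to c' \<C> \<and> C' \<in> c' \<and> c' \<noteq> a' \<longrightarrow>
        (\<exists>B\<^sub>1 C\<^sub>1. tangent_at b' \<C> B\<^sub>1 \<and> tangent_at c' \<C> C\<^sub>1 \<and>
           B\<^sub>1 \<noteq> A\<^sub>1 \<and> C\<^sub>1 \<noteq> A\<^sub>1 \<and> B\<^sub>1 \<noteq> C\<^sub>1 \<and>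
           is_triangle A\<^sub>1 B\<^sub>1 C\<^sub>1 \<and> is_circumcircle \<C> A\<^sub>1 B\<^sub>1 C\<^sub>1 \<and> is_euler_circle \<E> A\<^sub>1 B\<^sub>1 C\<^sub>1))"
    if meet: "meets_in_two_points a' \<E>' B' C'" for B' C'
  proof -
    have BC: "B' \<noteq> C'" "B' \<in> a' \<inter> \<E>'" "C' \<in> a' \<inter> \<E>'"
      using meet by (auto simp: meets_in_two_points_def)
    obtain q where q: "norm q = R" "norm (q - (h - a)) = R" "a + q \<noteq> 0" "B' = c + pole a q"
      using BC(2) unfolding key by blast
    obtain r where r: "norm r = R" "norm (r - (h - a)) = R" "a + r \<noteq> 0" "C' = c + pole a r"
      using BC(3) unfolding key by blast
    have qr: "q \<noteq> r" using BC(1) q(4) r(4) by auto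
    have ex1: "\<exists>!L. tangent_to L \<C> \<and> c + pole a p \<in> L \<and> L \<noteq> a'"
      if p: "norm p = R" "a + p \<noteq> 0" "c + pole a p \<noteq> A\<^sub>1" for p
    proof -
      have "p \<noteq> a"
      proof
        assume "p = a"
        then show False using p(3) pole_self[of a] R a by (auto simp: a_def)
      qed
      then show ?thesis
        using ex1_other_tangent[OF R T p(1)] p(2) assms(2) by (simp add: a_def)
    qed
    \<comment> \<open>That \<open>p\<close> differs from \<open>a\<close> is a conclusion: the mere
      existence of a second tangent \<open>L\<close> rules out the degenerate pole.\<close>
    have touch: "tangent_at L \<C> (c + p) \<and> p \<noteq> a"
      if p: "norm p = R" "a + p \<noteq> 0" and L: "tangent_to L \<C>" "c + pole a p \<in> L" "L \<noteq> a'" for L p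
    proof -
      obtain P where P: "tangent_at L (sphere c R) P"
        using L(1) assms(2) by (auto simp: tangent_to_def)
      then have P': "norm (P - c) = R" "L = {X. (X - c) \<bullet> (P - c) = R\<^sup>2}"
        by (simp_all add: tangent_at_sphere_iff[OF R])
      have "P \<noteq> A\<^sub>1" using tangent_at_sphere_point_eq_iff[OF R P T] L(3) by simp
      then have "P - c = p \<and> p \<noteq> a"
        using pole_chord_endpoint[OF R a p P'(1)] P'(2) L(2) by (simp add: a_def)
      then show ?thesis using P assms(2) by auto
    qed
    have "B' \<noteq> A\<^sub>1 \<longrightarrow> (\<exists>!b'. tangent_to b' \<C> \<and> B' \<in> b' \<and> b' \<noteq> a')"
      using ex1[OF q(1,3)] unfolding q(4) by (rule impI)
    moreover have "C' \<noteq> A\<^sub>1 \<longrightarrow> (\<exists>!c'. tangent_to c' \<C> \<and> C' \<in> c' \<and> c' \<noteq> a')"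
      using ex1[OF r(1,3)] unfolding r(4) by (rule impI)
    moreover have "\<forall>b' c'.
        tangent_to b' \<C> \<and> B' \<in> b' \<and> b' \<noteq> a' \<and>
        tangent_to c' \<C> \<and> C' \<in> c' \<and> c' \<noteq> a' \<longrightarrow>
        (\<exists>B\<^sub>1 C\<^sub>1. tangent_at b' \<C> B\<^sub>1 \<and> tangent_at c' \<C> C\<^sub>1 \<and>
           B\<^sub>1 \<noteq> A\<^sub>1 \<and> C\<^sub>1 \<noteq> A\<^sub>1 \<and> B\<^sub>1 \<noteq> C\<^sub>1 \<and>
           is_triangle A\<^sub>1 B\<^sub>1 C\<^sub>1 \<and> is_circumcircle \<C> A\<^sub>1 B\<^sub>1 C\<^sub>1 \<and> is_euler_circle \<E> A\<^sub>1 B\<^sub>1 C\<^sub>1)"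
    proof (intro allI impI)
      fix b' c'
      assume *: "tangent_to b' \<C> \<and> B' \<in> b' \<and> b' \<noteq> a' \<and>
        tangent_to c' \<C> \<and> C' \<in> c' \<and> c' \<noteq> a'"
      have b: "tangent_at b' \<C> (c + q)" "q \<noteq> a" and c: "tangent_at c' \<C> (c + r)" "r \<noteq> a"
        using * touch q r by blast+
      have neq: "c + q \<noteq> A\<^sub>1" "c + r \<noteq> A\<^sub>1" "c + q \<noteq> c + r"
        using b(2) c(2) qr by (auto simp: a_def)
      have circ: "is_circumcircle \<C> A\<^sub>1 (c + q) (c + r)"
        using R assms(2,5) q(1) r(1)
        by (auto simp: is_circumcircle_def is_circle_def dist_norm)
      have tri: "is_triangle A\<^sub>1 (c + q) (c + r)"
        unfolding is_triangle_def
        using distinct_on_sphere_not_collinear[of A\<^sub>1 c R "c + q" "c + r"] circ neq assms(2)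
        by (auto simp: is_circumcircle_def)
      \<comment> \<open>So the new triangle has the orthocentre \<open>h\<close> relative to
        \<open>c\<close>, hence the same Euler circle.\<close>
      have "q + r = h - a" by (rule equal_spheres_inter_sum[OF D qr q(1,2) r(1,2)])
      then have "h = (A\<^sub>1 - c) + (c + q - c) + (c + r - c)"
        by (simp add: a_def algebra_simps)
      then have "is_euler_circle \<E> A\<^sub>1 (c + q) (c + r)"
        using is_euler_circle_iff[OF R tri circ[unfolded assms(2)]] E by simp
      with b(1) c(1) neq circ tri show "\<exists>B\<^sub>1 C\<^sub>1. tangent_at b' \<C> B\<^sub>1 \<and> tangent_at c' \<C> C\<^sub>1 \<and>
           B\<^sub>1 \<noteq> A\<^sub>1 \<and> C\<^sub>1 \<noteq> A\<^sub>1 \<and> B\<^sub>1 \<noteq> C\<^sub>1 \<and>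
           is_triangle A\<^sub>1 B\<^sub>1 C\<^sub>1 \<and> is_circumcircle \<C> A\<^sub>1 B\<^sub>1 C\<^sub>1 \<and> is_euler_circle \<E> A\<^sub>1 B\<^sub>1 C\<^sub>1"
        by (intro exI[of _ "c + q"] exI[of _ "c + r"] conjI)
    qed
    ultimately show ?thesis by (intro conjI)
  qed
  ultimately show ?thesis by blast
qed

end
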